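(* Let $\mathbf{V}$ be a completely distributive (non-trivial) unital quantale. Then there is an isomorphism of categories $$\mathbf{Alg}(\mathsf{D},\mathbf{V})\cong\mathbf{Cls}(\mathbf{V}),$$ where $\mathsf{D}=(D,e,m)$ is the up-set monad, $\mathbf{Alg}(\mathsf{D},\mathbf{V})$ is the category of $(\mathsf{D},\mathbf{V})$-algebras associated to the Kleisli extension of $D$, and $\mathbf{Cls}(\mathbf{V})$ is the category of $\mathbf{V}$-closure spaces.
   Context: **Quantales and matrices.** A unital quantale $\mathbf{V}$ is a complete lattice with an associative operation $\otimes$ preserving suprema in each variable and a two-sided unit $k$; it is non-trivial if $\bot\neq k$. Write $a\prec b$ if for every $S\subseteq\mathbf{V}$ with $b\le\bigvee S$ there is $s\in S$ with $a\le s$. $\mathbf{V}$ is completely distributive if $b=\bigvee\{a\in\mathbf{V}\mid a\prec b\}$ for all $b\in\mathbf{V}$. A $\mathbf{V}$-matrix $r:X\nrightarrow Y$ is a map $r:X\times Y\to\mathbf{V}$; matrices are ordered pointwise. The composite of $r:X\nrightarrow Y$ and $s:Y\nrightarrow Z$ is $(s\cdot r)(x,z)=\bigvee_{y\in Y}r(x,y)\otimes s(y,z)$; identities are $1_X(x,y)=k$ if $x=y$ and $\bot$ otherwise. A map $f:X\to Y$ is identified with the matrix $f(x,y)=k$ if $f(x)=y$, and $\bot$ otherwise. $PX$ denotes the powerset of $X$. **Up-set monad.** An up-set on $X$ is a set $\mathfrak{x}$ of subsets of $X$ such that $A\in\mathfrak{x}$, $A\subseteq B\subseteq X$ imply $B\in\mathfrak{x}$.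 $DX$ is the set of all up-sets on $X$ (including $\emptyset$ and $PX$), ordered by reverse inclusion: $\mathfrak{x}\le\mathfrak{y}\iff\mathfrak{x}\supseteq\mathfrak{y}$; it is a complete lattice with suprema given by intersections. For $f:X\to Y$, $Df:DX\to DY$ is defined by $B\in Df(\mathfrak{x})\iff f^{-1}(B)\in\mathfrak{x}$. The monad $\mathsf{D}=(D,e,m)$ has $A\in e_X(x)\iff x\in A$ and $A\in m_X(\mathfrak{X})\iff\{\mathfrak{x}\in DX\mid A\in\mathfrak{x}\}\in\mathfrak{X}$, for $\mathfrak{X}\in D^2X$. **Kleisli extension.** Let $\eta_X:PX\to DX$, $\eta_X(A)=\bigvee\{e_X(x)\mid x\in A\}$. For a $\mathbf{V}$-matrix $r:X\nrightarrow Y$ and $a\in\mathbf{V}$ let $\rho_r^a:Y\to PX$, $\rho_r^a(y)=\{x\in X\mid a\le r(x,y)\}$. The Kleisli extension $D_M$ of $D$ sends $r:X\nrightarrow Y$ to $D_Mr:DX\nrightarrow DY$, $$D_Mr(\mathfrak{x},\mathfrak{y}):=\bigvee\{a\in\mathbf{V}\mid\mathfrak{x}\le m_X\cdot D(\eta_X\cdot\rho_r^a)(\mathfrak{y})\}.$$ **Lax algebras.** Objects of $\mathbf{Alg}(\mathsf{D},\mathbf{V})$ are pairs $(X,r)$ with $X$ a set and $r:DX\nrightarrow X$ a $\mathbf{V}$-matrix with $1_X\le r\cdot e_X$ and $r\cdot D_Mr\le r\cdot m_X$. Morphisms $f:(X,r)\to(Y,s)$ are maps $f:X\to Y$ with $r(\mathfrak{x},y)\le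 s(Df(\mathfrak{x}),f(y))$ for all $\mathfrak{x}\in DX$, $y\in X$; composition is as in $\mathbf{Set}$. **$\mathbf{V}$-closure spaces.** Objects of $\mathbf{Cls}(\mathbf{V})$ are pairs $(X,c)$ with $X$ a set and $c:PX\times X\to\mathbf{V}$ a map such that for all $x\in X$, $A,B\subseteq X$, $a\in\mathbf{V}$: (C1) $x\in A$ implies $k\le c(A,x)$; (C2) $A\subseteq B$ implies $c(A,x)\le c(B,x)$; (C3) $a\otimes c(c_a[A],x)\le c(A,x)$, where $c_a[A]:=\{x\in X\mid a\le c(A,x)\}$. A morphism $f:(X,c)\to(Y,d)$ is a map $f:X\to Y$ with $c(A,x)\le d(f(A),f(x))$ for all $A\subseteq X$, $x\in X$; composition is as in $\mathbf{Set}$. *)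

theory Defs
  imports Main "HOL-Library.FuncSet"
begin

section \<open>Categories\<close>

record ('o, 'm) cat =
  Obj :: "'o set"
  Hom :: "'o \<Rightarrow> 'o \<Rightarrow> 'm set"
  Ident :: "'o \<Rightarrow> 'm"
  Comp :: "'o \<Rightarrow> 'o \<Rightarrow> 'o \<Rightarrow> 'm \<Rightarrow> 'm \<Rightarrow> 'm"
    \<comment> \<open>\<open>Comp C X Y Z g f\<close> is the composite of \<open>f : X \<rightarrow> Y\<close> and \<open>g : Y \<rightarrow> Z\<close>\<close>

locale category =
  fixes C :: "('o, 'm) cat"
  assumes Ident_in: "X \<in> Obj C \<Longrightarrow> Ident C X \<in> Hom C X X"
    and Comp_in: "\<lbrakk>X \<in> Obj C; Y \<in> Obj C; Z \<in> Obj C; f \<in> Hom C X Y; g \<in> Hom C Y Z\<rbrakk>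
      \<Longrightarrow> Comp C X Y Z g f \<in> Hom C X Z"
    and Comp_Ident_right: "\<lbrakk>X \<in> Obj C; Y \<in> Obj C; f \<in> Hom C X Y\<rbrakk>
      \<Longrightarrow> Comp C X X Y f (Ident C X) = f"
    and Comp_Ident_left: "\<lbrakk>X \<in> Obj C; Y \<in> Obj C; f \<in> Hom C X Y\<rbrakk>
      \<Longrightarrow> Comp C X Y Y (Ident C Y) f = f"
    and Comp_assoc: "\<lbrakk>W \<in> Obj C; X \<in> Obj C; Y \<in> Obj C; Z \<in> Obj C;
        f \<in> Hom C W X; g \<in> Hom C X Y; h \<in> Hom C Y Z\<rbrakk>
      \<Longrightarrow> Comp C W X Z (Comp C X Y Z h g) f = Comp C W Y Z h (Comp C W X Y g f)"

locale cat_functor = C: category C + D: category D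
  for C :: "('o1, 'm1) cat" and D :: "('o2, 'm2) cat" +
  fixes Fo :: "'o1 \<Rightarrow> 'o2" and Fm :: "'o1 \<Rightarrow> 'o1 \<Rightarrow> 'm1 \<Rightarrow> 'm2"
  assumes Obj_in: "X \<in> Obj C \<Longrightarrow> Fo X \<in> Obj D"
    and Hom_in: "\<lbrakk>X \<in> Obj C; Y \<in> Obj C; f \<in> Hom C X Y\<rbrakk> \<Longrightarrow> Fm X Y f \<in> Hom D (Fo X) (Fo Y)"
    and map_Ident: "X \<in> Obj C \<Longrightarrow> Fm X X (Ident C X) = Ident D (Fo X)"
    and map_Comp: "\<lbrakk>X \<in> Obj C; Y \<in> Obj C; Z \<in> Obj C; f \<in> Hom C X Y; g \<in> Hom C Y Z\<rbrakk>
      \<Longrightarrow> Fm X Z (Comp C X Y Z g f) = Comp D (Fo X) (Fo Y) (Fo Z) (Fm Y Z g) (Fm X Y f)"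

definition isomorphic_categories :: "('o1, 'm1) cat \<Rightarrow> ('o2, 'm2) cat \<Rightarrow> bool" where
  "isomorphic_categories C D \<longleftrightarrow>
    (\<exists>Fo Fm Go Gm. cat_functor C D Fo Fm \<and> cat_functor D C Go Gm \<and>
      (\<forall>X\<in>Obj C. Go (Fo X) = X) \<and>
      (\<forall>X\<in>Obj C. \<forall>Y\<in>Obj C. \<forall>f\<in>Hom C X Y. Gm (Fo X) (Fo Y) (Fm X Y f) = f) \<and>
      (\<forall>X\<in>Obj D. Fo (Go X) = X) \<and>
      (\<forall>X\<in>Obj D. \<forall>Y\<in>Obj D. \<forall>g\<in>Hom D X Y. Fm (Go X) (Go Y) (Gm X Y g) = g))"


section \<open>Quantales and matrices\<close>

text \<open>The tensor is \<open>*\<close> and the unit \<open>k\<close> is \<open>1\<close>. Taking \<open>S\<close> empty, \<open>bot\<close> is absorbing.\<close>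

class unital_quantale = complete_lattice + monoid_mult +
  assumes mult_Sup: "a * Sup S = Sup ((\<lambda>s. a * s) ` S)"
    and Sup_mult: "Sup S * a = Sup ((\<lambda>s. s * a) ` S)"

definition totally_below :: "'v::complete_lattice \<Rightarrow> 'v \<Rightarrow> bool" (infix "\<prec>" 50) where
  "a \<prec> b \<longleftrightarrow> (\<forall>S. b \<le> Sup S \<longrightarrow> (\<exists>s\<in>S. a \<le> s))"

text \<open>Sets are subsets of a type; an arbitrary type \<open>'a\<close> plays the role of the universe
  from which the underlying sets of objects are drawn. Matrices and maps are extensional (\<open>undefined\<close> off their
  domain), so that equality of HOL functions is equality of matrices and of maps.\<close>

definition matrices :: "'x set \<Rightarrow> 'y set \<Rightarrow> ('x \<times> 'y \<Rightarrow> 'v) set" where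
  "matrices X Y = (X \<times> Y) \<rightarrow>\<^sub>E UNIV"

definition mat_le :: "'x set \<Rightarrow> 'y set \<Rightarrow> ('x \<times> 'y \<Rightarrow> 'v::order) \<Rightarrow> ('x \<times> 'y \<Rightarrow> 'v) \<Rightarrow> bool" where
  "mat_le X Y r s \<longleftrightarrow> (\<forall>x\<in>X. \<forall>y\<in>Y. r (x, y) \<le> s (x, y))"

text \<open>\<open>mat_comp X Y Z s r\<close> is \<open>s \<cdot> r\<close>.\<close>

definition mat_comp :: "'x set \<Rightarrow> 'y set \<Rightarrow> 'z set \<Rightarrow>
    ('y \<times> 'z \<Rightarrow> 'v::unital_quantale) \<Rightarrow> ('x \<times> 'y \<Rightarrow> 'v) \<Rightarrow> 'x \<times> 'z \<Rightarrow> 'v" where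
  "mat_comp X Y Z s r = (\<lambda>(x, z)\<in>X \<times> Z. SUP y\<in>Y. r (x, y) * s (y, z))"

definition mat_id :: "'x set \<Rightarrow> 'x \<times> 'x \<Rightarrow> 'v::unital_quantale" where
  "mat_id X = (\<lambda>(x, y)\<in>X \<times> X. if x = y then 1 else bot)"

definition mat_of_map :: "'x set \<Rightarrow> 'y set \<Rightarrow> ('x \<Rightarrow> 'y) \<Rightarrow> 'x \<times> 'y \<Rightarrow> 'v::unital_quantale" where
  "mat_of_map X Y f = (\<lambda>(x, y)\<in>X \<times> Y. if f x = y then 1 else bot)"


section \<open>The up-set monad and its Kleisli extension\<close>

definition upsets :: "'a set \<Rightarrow> 'a set set set" where
  "upsets X = {\<xx>. \<xx> \<subseteq> Pow X \<and> (\<forall>A B. A \<in> \<xx> \<longrightarrow> A \<subseteq> B \<longrightarrow> B \<subseteq> X \<longrightarrow> B \<in> \<xx>)}"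

definition D_le :: "'a set set \<Rightarrow> 'a set set \<Rightarrow> bool" where
  "D_le \<xx> \<yy> \<longleftrightarrow> \<xx> \<supseteq> \<yy>"

text \<open>Supremum in \<open>upsets X\<close>: the intersection taken inside \<open>Pow X\<close>, which is
  the supremum of the empty family.\<close>

definition D_Sup :: "'a set \<Rightarrow> 'a set set set \<Rightarrow> 'a set set" where
  "D_Sup X S = {A. A \<subseteq> X \<and> (\<forall>\<xx>\<in>S. A \<in> \<xx>)}"

definition D_map :: "'x set \<Rightarrow> 'y set \<Rightarrow> ('x \<Rightarrow> 'y) \<Rightarrow> 'x set set \<Rightarrow> 'y set set" where
  "D_map X Y f \<xx> = {B. B \<subseteq> Y \<and> f -` B \<inter> X \<in> \<xx>}"

definition D_unit :: "'a set \<Rightarrow> 'a \<Rightarrow> 'a set set" where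
  "D_unit X x = {A. A \<subseteq> X \<and> x \<in> A}"

definition D_mult :: "'a set \<Rightarrow> 'a set set set set \<Rightarrow> 'a set set" where
  "D_mult X \<XX> = {A. A \<subseteq> X \<and> {\<xx> \<in> upsets X. A \<in> \<xx>} \<in> \<XX>}"

definition D_eta :: "'a set \<Rightarrow> 'a set \<Rightarrow> 'a set set" where
  "D_eta X A = D_Sup X (D_unit X ` A)"

definition rho :: "'x set \<Rightarrow> ('x \<times> 'y \<Rightarrow> 'v::order) \<Rightarrow> 'v \<Rightarrow> 'y \<Rightarrow> 'x set" where
  "rho X r a y = {x \<in> X. a \<le> r (x, y)}"

definition D_ext :: "'x set \<Rightarrow> 'y set \<Rightarrow> ('x \<times> 'y \<Rightarrow> 'v::unital_quantale) \<Rightarrow>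
    'x set set \<times> 'y set set \<Rightarrow> 'v" where
  "D_ext X Y r = (\<lambda>(\<xx>, \<yy>)\<in>upsets X \<times> upsets Y.
    Sup {a. D_le \<xx> (D_mult X (D_map Y (upsets X) (D_eta X \<circ> rho X r a) \<yy>))})"


section \<open>Lax algebras and closure spaces\<close>

type_synonym ('a, 'v) alg = "'a set \<times> ('a set set \<times> 'a \<Rightarrow> 'v)"

definition is_alg :: "('a, 'v::unital_quantale) alg \<Rightarrow> bool" where
  "is_alg = (\<lambda>(X, r). r \<in> matrices (upsets X) X \<and>
    mat_le X X (mat_id X)
      (mat_comp X (upsets X) X r (mat_of_map X (upsets X) (D_unit X))) \<and>
    mat_le (upsets (upsets X)) X
      (mat_comp (upsets (upsets X)) (upsets X) X r (D_ext (upsets X) X r))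
      (mat_comp (upsets (upsets X)) (upsets X) X r
        (mat_of_map (upsets (upsets X)) (upsets X) (D_mult X))))"

definition alg_hom :: "('a, 'v::unital_quantale) alg \<Rightarrow> ('a, 'v) alg \<Rightarrow> ('a \<Rightarrow> 'a) set" where
  "alg_hom = (\<lambda>(X, r) (Y, s). {f \<in> X \<rightarrow>\<^sub>E Y.
    \<forall>\<xx>\<in>upsets X. \<forall>y\<in>X. r (\<xx>, y) \<le> s (D_map X Y f \<xx>, f y)})"

definition Alg :: "(('a, 'v::unital_quantale) alg, 'a \<Rightarrow> 'a) cat" where
  "Alg = \<lparr>Obj = {A. is_alg A}, Hom = alg_hom,
    Ident = (\<lambda>A. \<lambda>x\<in>fst A. x), Comp = (\<lambda>A B C g f. compose (fst A) g f)\<rparr>"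

type_synonym ('a, 'v) closure_space = "'a set \<times> ('a set \<times> 'a \<Rightarrow> 'v)"

definition is_closure_space :: "('a, 'v::unital_quantale) closure_space \<Rightarrow> bool" where
  "is_closure_space = (\<lambda>(X, c). c \<in> matrices (Pow X) X \<and>
    (\<forall>x\<in>X. \<forall>A. A \<subseteq> X \<longrightarrow> x \<in> A \<longrightarrow> 1 \<le> c (A, x)) \<and>
    (\<forall>x\<in>X. \<forall>A B. A \<subseteq> X \<longrightarrow> B \<subseteq> X \<longrightarrow> A \<subseteq> B \<longrightarrow> c (A, x) \<le> c (B, x)) \<and>
    (\<forall>x\<in>X. \<forall>A a. A \<subseteq> X \<longrightarrow> a * c ({y \<in> X. a \<le> c (A, y)}, x) \<le> c (A, x)))"

definition closure_hom ::
    "('a, 'v::unital_quantale) closure_space \<Rightarrow> ('a, 'v) closure_space \<Rightarrow> ('a \<Rightarrow> 'a) set" where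
  "closure_hom = (\<lambda>(X, c) (Y, d). {f \<in> X \<rightarrow>\<^sub>E Y.
    \<forall>A x. A \<subseteq> X \<longrightarrow> x \<in> X \<longrightarrow> c (A, x) \<le> d (f ` A, f x)})"

definition Cls :: "(('a, 'v::unital_quantale) closure_space, 'a \<Rightarrow> 'a) cat" where
  "Cls = \<lparr>Obj = {A. is_closure_space A}, Hom = closure_hom,
    Ident = (\<lambda>A. \<lambda>x\<in>fst A. x), Comp = (\<lambda>A B C g f. compose (fst A) g f)\<rparr>"

end

theory Submission imports Defs begin

text \<open>For a subset \<open>A\<close> of \<open>X\<close> let the grill of \<open>A\<close> be the up-set of all subsets of \<open>X\<close> that meet
  \<open>A\<close>. An algebra structure \<open>r\<close> corresponds to \<open>c (A, x) = r (grill A, x)\<close>. It is recovered from \<open>c\<close>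
  because every up-set is the intersection of the grills containing it, and the multiplication law,
  applied to a unit up-set, forces \<open>r\<close> to preserve intersections in its first argument. Since an up-set
  \<open>\<xx>\<close> lies in the grill of \<open>A\<close> iff \<open>X - A \<notin> \<xx>\<close>, the inverse sends \<open>c\<close> to the infimum of all
  \<open>c (A, x)\<close> with \<open>X - A \<notin> \<xx>\<close>. Under this correspondence the unit and multiplication laws become (C1)
  and (C3), and morphisms agree because \<open>D_map f\<close> sends the grill of \<open>A\<close> to the grill of \<open>f ` A\<close>.\<close>

section \<open>Quantales\<close>

lemma bot_mult [simp]: "(bot::'v::unital_quantale) * a = bot"
  using Sup_mult[of "{}" a] by simp

lemma quantale_mult_left_mono: "b \<le> c \<Longrightarrow> (a::'v::unital_quantale) * b \<le> a * c"
  using mult_Sup[of a "{b, c}"] by (simp add: le_iff_sup sup_absorb2)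

text \<open>Only the term at \<open>z\<close> survives because \<open>bot\<close> is absorbing. This
  evaluates a composite with the matrix of a map at a point.\<close>

lemma SUP_unit_mult:
  fixes g :: "'b \<Rightarrow> 'v::unital_quantale"
  assumes "z \<in> S"
  shows "(SUP y\<in>S. (if z = y then 1 else bot) * g y) = g z"
proof (rule antisym)
  show "(SUP y\<in>S. (if z = y then 1 else bot) * g y) \<le> g z"
    by (rule SUP_least) auto
  show "g z \<le> (SUP y\<in>S. (if z = y then 1 else bot) * g y)"
    by (rule SUP_upper2[OF assms]) simp
qed

section \<open>Up-sets\<close>

lemma upsetsI:
  assumes "\<xx> \<subseteq> Pow X" "\<And>A B. A \<in> \<xx> \<Longrightarrow> A \<subseteq> B \<Longrightarrow> B \<subseteq> X \<Longrightarrow> B \<in> \<xx>"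
  shows "\<xx> \<in> upsets X"
  using assms by (auto simp: upsets_def)

lemma upsetsD: "\<xx> \<in> upsets X \<Longrightarrow> A \<in> \<xx> \<Longrightarrow> A \<subseteq> B \<Longrightarrow> B \<subseteq> X \<Longrightarrow> B \<in> \<xx>"
  unfolding upsets_def by blast

lemma upsets_subset: "\<xx> \<in> upsets X \<Longrightarrow> A \<in> \<xx> \<Longrightarrow> A \<subseteq> X"
  unfolding upsets_def by blast

lemma D_unit_in_upsets [simp]: "D_unit X x \<in> upsets X"
  by (rule upsetsI) (auto simp: D_unit_def)

lemma D_mult_in_upsets [simp]:
  assumes "\<XX> \<in> upsets (upsets X)"
  shows "D_mult X \<XX> \<in> upsets X"
proof (rule upsetsI)
  fix A B assume "A \<in> D_mult X \<XX>" "A \<subseteq> B" "B \<subseteq> X"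
  moreover from this have "{\<xx> \<in> upsets X. A \<in> \<xx>} \<subseteq> {\<xx> \<in> upsets X. B \<in> \<xx>}"
    by (auto intro: upsetsD)
  ultimately show "B \<in> D_mult X \<XX>"
    unfolding D_mult_def using upsetsD[OF assms] by blast
qed (auto simp: D_mult_def)

lemma D_map_in_upsets [simp]:
  assumes "\<xx> \<in> upsets X"
  shows "D_map X Y f \<xx> \<in> upsets Y"
proof (rule upsetsI)
  fix A B assume *: "A \<in> D_map X Y f \<xx>" "A \<subseteq> B" "B \<subseteq> Y"
  hence "f -` A \<inter> X \<in> \<xx>" "f -` A \<inter> X \<subseteq> f -` B \<inter> X" by (auto simp: D_map_def)
  with * show "B \<in> D_map X Y f \<xx>"
    unfolding D_map_def using upsetsD[OF assms] by blast
qed (auto simp: D_map_def)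

lemma D_eta_eq: "A \<subseteq> X \<Longrightarrow> D_eta X A = {B. A \<subseteq> B \<and> B \<subseteq> X}"
  by (auto simp: D_eta_def D_Sup_def D_unit_def)

lemma D_eta_in_upsets [simp]: "D_eta X A \<in> upsets X"
  by (rule upsetsI) (auto simp: D_eta_def D_Sup_def D_unit_def)

text \<open>\<open>D_eta\<close> of a subset of \<open>X\<close> is the principal up-set of its
  supersets, so membership of \<open>A\<close> in it becomes an inclusion, and the Kleisli extension
  reduces to a condition on preimages.\<close>

lemma D_ext_eq:
  assumes "\<xx> \<in> upsets X" "\<yy> \<in> upsets Y"
  shows "D_ext X Y r (\<xx>, \<yy>) =
    Sup {a. \<forall>A\<subseteq>X. {y \<in> Y. rho X r a y \<subseteq> A} \<in> \<yy> \<longrightarrow> A \<in> \<xx>}"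
proof -
  have "A \<in> D_eta X (rho X r a y) \<longleftrightarrow> rho X r a y \<subseteq> A" if "A \<subseteq> X" for A a y
    using that by (subst D_eta_eq) (auto simp: rho_def)
  hence "(D_eta X \<circ> rho X r a) -` {\<zz> \<in> upsets X. A \<in> \<zz>} \<inter> Y = {y \<in> Y. rho X r a y \<subseteq> A}"
    if "A \<subseteq> X" for A a
    using that by auto
  hence "D_mult X (D_map Y (upsets X) (D_eta X \<circ> rho X r a) \<yy>) =
      {A. A \<subseteq> X \<and> {y \<in> Y. rho X r a y \<subseteq> A} \<in> \<yy>}" for a
    by (auto simp: D_mult_def D_map_def)
  thus ?thesis
    using assms by (simp add: D_ext_def D_le_def) (rule arg_cong[where f = Sup], blast)
qed

text \<open>This is the union of the up-sets \<open>D_unit X x\<close> for \<open>x\<close> in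
  \<open>A\<close>, hence their infimum under reverse inclusion; dually, \<open>D_eta X A\<close> is
  their intersection.\<close>

definition grill :: "'a set \<Rightarrow> 'a set \<Rightarrow> 'a set set" where
  "grill X A = {B. B \<subseteq> X \<and> B \<inter> A \<noteq> {}}"

lemma grill_in_upsets [simp]: "grill X A \<in> upsets X"
  by (rule upsetsI) (auto simp: grill_def)

lemma grill_mono: "A \<subseteq> B \<Longrightarrow> grill X A \<subseteq> grill X B"
  by (auto simp: grill_def)

lemma D_unit_subset_grill: "x \<in> A \<Longrightarrow> D_unit X x \<subseteq> grill X A"
  by (auto simp: grill_def D_unit_def)

text \<open>A member of \<xx> that misses \<open>A\<close> lies inside \<open>X - A\<close>, and
  up-closure then puts \<open>X - A\<close> itself into \<xx>.\<close>

lemma upset_subset_grill_iff: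
  assumes "\<xx> \<in> upsets X" "A \<subseteq> X"
  shows "\<xx> \<subseteq> grill X A \<longleftrightarrow> X - A \<notin> \<xx>"
proof
  show "X - A \<notin> \<xx>" if "\<xx> \<subseteq> grill X A"
    using that by (auto simp: grill_def)
  show "\<xx> \<subseteq> grill X A" if notin: "X - A \<notin> \<xx>"
  proof
    fix B assume B: "B \<in> \<xx>"
    hence "\<not> B \<subseteq> X - A" using notin upsetsD[OF assms(1) B, of "X - A"] by blast
    with upsets_subset[OF assms(1) B] show "B \<in> grill X A" by (auto simp: grill_def)
  qed
qed

lemma D_map_grill:
  assumes "f ` X \<subseteq> Y" "A \<subseteq> X"
  shows "D_map X Y f (grill X A) = grill Y (f ` A)"
  using assms by (auto simp: D_map_def grill_def)

section \<open>Lax algebras\<close>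

text \<open>Composites with the unit and multiplication maps are evaluations of \<open>r\<close>. In
  the remaining composite \<open>D_ext\<close> is a supremum, and the tensor distributes over it, so
  the multiplication law splits into one inequality for each \<yy> and each admissible
  \<open>a\<close>.\<close>

lemma is_alg_iff:
  "is_alg (X, r) \<longleftrightarrow> r \<in> matrices (upsets X) X \<and>
    (\<forall>x\<in>X. 1 \<le> r (D_unit X x, x)) \<and>
    (\<forall>\<XX>\<in>upsets (upsets X). \<forall>\<yy>\<in>upsets X. \<forall>x\<in>X. \<forall>a.
      (\<forall>\<A>\<subseteq>upsets X. {y \<in> X. rho (upsets X) r a y \<subseteq> \<A>} \<in> \<yy> \<longrightarrow> \<A> \<in> \<XX>) \<longrightarrow>
      a * r (\<yy>, x) \<le> r (D_mult X \<XX>, x))"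
proof -
  have map: "mat_comp W (upsets X) X r (mat_of_map W (upsets X) g) (w, x) = r (g w, x)"
    if "w \<in> W" "x \<in> X" "g w \<in> upsets X" for W :: "'c set" and g w x
  proof -
    have "mat_comp W (upsets X) X r (mat_of_map W (upsets X) g) (w, x) =
        (SUP \<yy>\<in>upsets X. (if g w = \<yy> then 1 else bot) * r (\<yy>, x))"
      using that(1,2) by (auto simp: mat_comp_def mat_of_map_def intro!: SUP_cong)
    thus ?thesis using SUP_unit_mult[OF that(3)] by simp
  qed
  have unit: "mat_le X X (mat_id X)
      (mat_comp X (upsets X) X r (mat_of_map X (upsets X) (D_unit X))) \<longleftrightarrow>
      (\<forall>x\<in>X. 1 \<le> r (D_unit X x, x))"
    by (auto simp: mat_le_def map mat_id_def)
  have mult: "mat_comp (upsets (upsets X)) (upsets X) X r (D_ext (upsets X) X r) (\<XX>, x) \<le> b \<longleftrightarrow>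
      (\<forall>\<yy>\<in>upsets X. \<forall>a.
        (\<forall>\<A>\<subseteq>upsets X. {y \<in> X. rho (upsets X) r a y \<subseteq> \<A>} \<in> \<yy> \<longrightarrow> \<A> \<in> \<XX>) \<longrightarrow>
        a * r (\<yy>, x) \<le> b)"
    if "\<XX> \<in> upsets (upsets X)" "x \<in> X" for \<XX> x b
    using that by (simp add: mat_comp_def SUP_le_iff D_ext_eq Sup_mult)
  show ?thesis
    unfolding is_alg_def by (simp add: unit) (auto simp: mat_le_def map mult)
qed

locale lax_algebra =
  fixes X :: "'a set" and r :: "'a set set \<times> 'a \<Rightarrow> 'v::unital_quantale"
  assumes alg: "is_alg (X, r)"
begin

lemma matrix: "r \<in> matrices (upsets X) X"
  using alg by (simp add: is_alg_iff)

lemma unit: "x \<in> X \<Longrightarrow> 1 \<le> r (D_unit X x, x)"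
  using alg by (simp add: is_alg_iff)

lemma mult:
  assumes "\<XX> \<in> upsets (upsets X)" "\<yy> \<in> upsets X" "x \<in> X"
    and "\<And>\<A>. \<A> \<subseteq> upsets X \<Longrightarrow> {y \<in> X. rho (upsets X) r a y \<subseteq> \<A>} \<in> \<yy> \<Longrightarrow> \<A> \<in> \<XX>"
  shows "a * r (\<yy>, x) \<le> r (D_mult X \<XX>, x)"
  using alg assms unfolding is_alg_iff by blast

text \<open>Apply the multiplication law with \<open>a = 1\<close> to the image of \<xx> under
  \<open>D_map\<close> of the unit. The unit law puts \<open>D_unit X y\<close> into
  \<open>rho (upsets X) r 1 y\<close>, which verifies the hypothesis, and a monad unit law turns
  \<open>D_mult X ?E\<close> back into \<xx>.\<close>

lemma mono:
  assumes "\<yy> \<in> upsets X" "\<xx> \<in> upsets X" "\<yy> \<subseteq> \<xx>" "x \<in> X"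
  shows "r (\<yy>, x) \<le> r (\<xx>, x)"
proof -
  let ?E = "D_map X (upsets X) (D_unit X) \<xx>"
  have "1 * r (\<yy>, x) \<le> r (D_mult X ?E, x)"
  proof (rule mult)
    fix \<A> assume \<A>: "\<A> \<subseteq> upsets X" "{y \<in> X. rho (upsets X) r 1 y \<subseteq> \<A>} \<in> \<yy>"
    moreover have "{y \<in> X. rho (upsets X) r 1 y \<subseteq> \<A>} \<subseteq> D_unit X -` \<A> \<inter> X"
      using unit D_unit_in_upsets[of X] unfolding rho_def by blast
    ultimately have "D_unit X -` \<A> \<inter> X \<in> \<xx>"
      using assms upsetsD[OF assms(2)] by blast
    thus "\<A> \<in> ?E" using \<A> by (simp add: D_map_def)
  qed (use assms in auto)
  also have "D_mult X ?E = \<xx>"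
  proof -
    have "A \<in> D_unit X y \<longleftrightarrow> y \<in> A" if "A \<subseteq> X" for A y
      using that by (simp add: D_unit_def)
    hence "D_unit X -` {\<zz> \<in> upsets X. A \<in> \<zz>} \<inter> X = A" if "A \<subseteq> X" for A
      using that by auto
    thus ?thesis using upsets_subset[OF assms(2)] by (auto simp: D_mult_def D_map_def)
  qed
  finally show ?thesis by simp
qed

text \<open>The multiplication law at \<open>D_unit X x\<close> and the principal up-set of all \<open>\<zz>\<close> with
  \<open>a \<le> r (\<zz>, x)\<close>.\<close>

lemma le_if_Inter_subset:
  assumes "x \<in> X" "\<xx> \<in> upsets X"
    and sub: "\<And>A. A \<subseteq> X \<Longrightarrow> (\<And>\<zz>. \<zz> \<in> upsets X \<Longrightarrow> a \<le> r (\<zz>, x) \<Longrightarrow> A \<in> \<zz>) \<Longrightarrow> A \<in> \<xx>"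
  shows "a \<le> r (\<xx>, x)"
proof -
  let ?Z = "rho (upsets X) r a x"
  let ?E = "D_eta (upsets X) ?Z"
  have E: "?E = {\<A>. ?Z \<subseteq> \<A> \<and> \<A> \<subseteq> upsets X}" by (rule D_eta_eq) (auto simp: rho_def)
  have "a = a * 1" by simp
  also have "\<dots> \<le> a * r (D_unit X x, x)"
    by (intro quantale_mult_left_mono unit assms)
  also have "\<dots> \<le> r (D_mult X ?E, x)"
  proof (rule mult)
    fix \<A> assume "\<A> \<subseteq> upsets X" "{y \<in> X. rho (upsets X) r a y \<subseteq> \<A>} \<in> D_unit X x"
    thus "\<A> \<in> ?E" by (auto simp: E D_unit_def)
  qed (use assms in auto)
  also have "\<dots> \<le> r (\<xx>, x)"
  proof (rule mono)
    \<comment> \<open>\<open>D_mult X ?E\<close> consists of the subsets of \<open>X\<close> that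
      belong to every member of \<open>?Z\<close>, which is the situation of
      \<open>sub\<close>.\<close>
    show "D_mult X ?E \<subseteq> \<xx>"
    proof
      fix A assume "A \<in> D_mult X ?E"
      hence "A \<subseteq> X" "?Z \<subseteq> {\<zz> \<in> upsets X. A \<in> \<zz>}" by (auto simp: D_mult_def E)
      thus "A \<in> \<xx>" by (intro sub) (auto simp: rho_def)
    qed
  qed (use assms in auto)
  finally show ?thesis .
qed

lemma eq_INF_grill:
  assumes "\<xx> \<in> upsets X" "x \<in> X"
  shows "r (\<xx>, x) = (INF A\<in>{A. A \<subseteq> X \<and> X - A \<notin> \<xx>}. r (grill X A, x))"
proof (rule antisym)
  show "r (\<xx>, x) \<le> (INF A\<in>{A. A \<subseteq> X \<and> X - A \<notin> \<xx>}. r (grill X A, x))"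
    using assms by (intro INF_greatest mono) (simp_all add: upset_subset_grill_iff)
  show "(INF A\<in>{A. A \<subseteq> X \<and> X - A \<notin> \<xx>}. r (grill X A, x)) \<le> r (\<xx>, x)" (is "?b \<le> _")
  proof (rule le_if_Inter_subset[OF assms(2,1)], rule ccontr)
    fix A assume A: "A \<subseteq> X" "\<And>\<zz>. \<zz> \<in> upsets X \<Longrightarrow> ?b \<le> r (\<zz>, x) \<Longrightarrow> A \<in> \<zz>" "A \<notin> \<xx>"
    \<comment> \<open>The complement of \<open>X - A\<close> is \<open>A\<close>, which is not in
      \<xx>, so \<open>X - A\<close> is an admissible index; yet its grill omits
      \<open>A\<close>.\<close>
    have "?b \<le> r (grill X (X - A), x)"
      by (rule INF_lower) (use A in \<open>simp add: double_diff\<close>)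
    hence "A \<in> grill X (X - A)" using A(2) grill_in_upsets by blast
    thus False by (auto simp: grill_def)
  qed
qed

end

section \<open>The two object maps\<close>

definition alg_closure :: "('a, 'v::unital_quantale) alg \<Rightarrow> ('a, 'v) closure_space" where
  "alg_closure = (\<lambda>(X, r). (X, \<lambda>(A, x)\<in>Pow X \<times> X. r (grill X A, x)))"

text \<open>For \<xx> = \<open>Pow X\<close> no index is admissible, and the infimum is the top
  element.\<close>

definition closure_alg :: "('a, 'v::unital_quantale) closure_space \<Rightarrow> ('a, 'v) alg" where
  "closure_alg = (\<lambda>(X, c). (X, \<lambda>(\<xx>, x)\<in>upsets X \<times> X. INF A\<in>{A. A \<subseteq> X \<and> X - A \<notin> \<xx>}. c (A, x)))"

lemma fst_alg_closure [simp]: "fst (alg_closure S) = fst S"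
  by (simp add: alg_closure_def split: prod.split)

lemma is_closure_space_alg_closure:
  assumes "is_alg S"
  shows "is_closure_space (alg_closure S)"
proof -
  obtain X r where S: "S = (X, r)" by fastforce
  interpret lax_algebra X r using assms by unfold_locales (simp add: S)
  have C3: "a * r (grill X {y \<in> X. a \<le> r (grill X A, y)}, x) \<le> r (grill X A, x)"
    if "A \<subseteq> X" "x \<in> X" for A a x
  proof -
    let ?Y = "grill X {y \<in> X. a \<le> r (grill X A, y)}"
    \<comment> \<open>The least choice of \<XX> that meets the hypothesis of \<open>mult\<close> for
      \<open>a\<close> and \<open>?Y\<close>.\<close>
    let ?E = "{\<A>. \<A> \<subseteq> upsets X \<and> {y \<in> X. rho (upsets X) r a y \<subseteq> \<A>} \<in> ?Y}"
    have E: "?E \<in> upsets (upsets X)"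
    proof (rule upsetsI)
      fix \<A> \<B> assume *: "\<A> \<in> ?E" "\<A> \<subseteq> \<B>" "\<B> \<subseteq> upsets X"
      hence "{y \<in> X. rho (upsets X) r a y \<subseteq> \<A>} \<subseteq> {y \<in> X. rho (upsets X) r a y \<subseteq> \<B>}" by blast
      with * show "\<B> \<in> ?E" using upsetsD[OF grill_in_upsets[of X]] by blast
    qed blast
    have "a * r (?Y, x) \<le> r (D_mult X ?E, x)"
      by (rule mult) (use that E in auto)
    also have "\<dots> \<le> r (grill X A, x)"
    proof (rule mono)
      \<comment> \<open>A member \<open>B\<close> yields a point \<open>y\<close> with
        \<open>a \<le> r (grill X A, y)\<close> such that every \<zz> with
        \<open>a \<le> r (\<zz>, y)\<close> contains \<open>B\<close>; the grill of \<open>A\<close>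
        is one such \<zz>.\<close>
      show "D_mult X ?E \<subseteq> grill X A"
      proof
        fix B assume "B \<in> D_mult X ?E"
        then obtain y where "a \<le> r (grill X A, y)" "rho (upsets X) r a y \<subseteq> {\<zz> \<in> upsets X. B \<in> \<zz>}"
          by (auto simp: D_mult_def grill_def)
        thus "B \<in> grill X A" using grill_in_upsets[of X A] unfolding rho_def by blast
      qed
    qed (use that E in auto)
    finally show ?thesis .
  qed
  have C1: "1 \<le> r (grill X A, x)" if "x \<in> X" "x \<in> A" for A x
    using unit[OF that(1)] mono[OF _ _ D_unit_subset_grill[OF that(2)] that(1)]
    by (meson D_unit_in_upsets grill_in_upsets order_trans)
  have C2: "r (grill X A, x) \<le> r (grill X B, x)" if "A \<subseteq> B" "x \<in> X" for A B x
    using that by (intro mono grill_mono) auto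
  have sub: "{y \<in> X. P y} \<subseteq> X" for P by blast
  show ?thesis
    using C1 C2 C3
    by (simp add: S alg_closure_def is_closure_space_def matrices_def sub cong: conj_cong)
qed

section \<open>From closure spaces to algebras\<close>

locale closure_space =
  fixes X :: "'a set" and c :: "'a set \<times> 'a \<Rightarrow> 'v::unital_quantale"
  assumes closure_space: "is_closure_space (X, c)"
begin

lemma matrix: "c \<in> matrices (Pow X) X"
  and C1: "x \<in> A \<Longrightarrow> A \<subseteq> X \<Longrightarrow> 1 \<le> c (A, x)"
  and C2: "A \<subseteq> B \<Longrightarrow> B \<subseteq> X \<Longrightarrow> x \<in> X \<Longrightarrow> c (A, x) \<le> c (B, x)"
  and C3: "A \<subseteq> X \<Longrightarrow> x \<in> X \<Longrightarrow> a * c ({y \<in> X. a \<le> c (A, y)}, x) \<le> c (A, x)"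
  using closure_space unfolding is_closure_space_def by auto

lemma closure_alg_le:
  assumes "\<xx> \<in> upsets X" "x \<in> X" "A \<subseteq> X" "X - A \<notin> \<xx>"
  shows "snd (closure_alg (X, c)) (\<xx>, x) \<le> c (A, x)"
  using assms by (auto simp: closure_alg_def intro: INF_lower)

lemma le_closure_alg:
  assumes "\<xx> \<in> upsets X" "x \<in> X" "\<And>A. A \<subseteq> X \<Longrightarrow> X - A \<notin> \<xx> \<Longrightarrow> b \<le> c (A, x)"
  shows "b \<le> snd (closure_alg (X, c)) (\<xx>, x)"
  using assms by (auto simp: closure_alg_def intro: INF_greatest)

text \<open>The admissible indices for the grill of \<open>A\<close> are exactly the supersets of
  \<open>A\<close> in \<open>X\<close>, so by (C2) the infimum is attained at
  \<open>A\<close>.\<close>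

lemma closure_alg_grill:
  assumes "A \<subseteq> X" "x \<in> X"
  shows "snd (closure_alg (X, c)) (grill X A, x) = c (A, x)"
proof (rule antisym)
  show "snd (closure_alg (X, c)) (grill X A, x) \<le> c (A, x)"
    by (rule closure_alg_le[OF grill_in_upsets assms(2,1)]) (use assms in \<open>auto simp: grill_def\<close>)
  show "c (A, x) \<le> snd (closure_alg (X, c)) (grill X A, x)"
    by (rule le_closure_alg[OF grill_in_upsets assms(2)])
      (use assms in \<open>auto intro!: C2 simp: grill_def\<close>)
qed

end

lemma is_alg_closure_alg:
  assumes "is_closure_space S"
  shows "is_alg (closure_alg S)"
proof -
  obtain X c where S: "S = (X, c)" by fastforce
  interpret closure_space X c using assms by unfold_locales (simp add: S)
  define r where "r = snd (closure_alg S)"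
  have alg: "closure_alg S = (X, r)"
    by (simp add: r_def closure_alg_def S)
  have "r \<in> matrices (upsets X) X"
    by (auto simp: r_def closure_alg_def S matrices_def)
  moreover have "1 \<le> r (D_unit X x, x)" if "x \<in> X" for x
    unfolding r_def S by (rule le_closure_alg[OF D_unit_in_upsets that])
      (use that in \<open>auto intro!: C1 simp: D_unit_def\<close>)
  moreover have "a * r (\<yy>, x) \<le> r (D_mult X \<XX>, x)"
    if \<XX>: "\<XX> \<in> upsets (upsets X)" and \<yy>: "\<yy> \<in> upsets X" and x: "x \<in> X"
      and H: "\<forall>\<A>\<subseteq>upsets X. {y \<in> X. rho (upsets X) r a y \<subseteq> \<A>} \<in> \<yy> \<longrightarrow> \<A> \<in> \<XX>"
    for \<XX> \<yy> x a
  proof -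
    \<comment> \<open>The right-hand side of the law is an infimum, so each admissible index
      \<open>B\<close> is bounded separately.\<close>
    have "a * r (\<yy>, x) \<le> c (B, x)" if B: "B \<subseteq> X" "X - B \<notin> D_mult X \<XX>" for B
    proof -
      let ?A = "{\<zz> \<in> upsets X. X - B \<in> \<zz>}" and ?C = "{y \<in> X. a \<le> c (B, y)}"
      have "{y \<in> X. rho (upsets X) r a y \<subseteq> ?A} \<notin> \<yy>"
        using B H by (auto simp: D_mult_def)
      \<comment> \<open>If some \<zz> with \<open>a \<le> r (\<zz>, y)\<close> omitted
        \<open>X - B\<close>, then \<open>B\<close> would be an index for \<zz>, giving
        \<open>a \<le> c (B, y)\<close> and so \<open>y\<close> in \<open>?C\<close>.\<close>
      moreover have "X - ?C \<subseteq> {y \<in> X. rho (upsets X) r a y \<subseteq> ?A}"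
      proof
        fix y assume y: "y \<in> X - ?C"
        have "X - B \<in> \<zz>" if "\<zz> \<in> upsets X" "a \<le> r (\<zz>, y)" for \<zz>
          using y that B closure_alg_le[of \<zz> y B] unfolding r_def S by (auto intro: order_trans)
        thus "y \<in> {y \<in> X. rho (upsets X) r a y \<subseteq> ?A}" using y by (auto simp: rho_def)
      qed
      ultimately have "X - ?C \<notin> \<yy>" using upsetsD[OF \<yy>, of "X - ?C"] by blast
      \<comment> \<open>Now \<open>?C\<close> is an admissible index for \<yy>; tensoring with
        \<open>a\<close> gives exactly the left-hand side of (C3) for \<open>B\<close>.\<close>
      hence "r (\<yy>, x) \<le> c (?C, x)"
        unfolding r_def S by (intro closure_alg_le \<yy> x) auto
      thus ?thesis
        using quantale_mult_left_mono[of _ _ a] C3[OF B(1) x] order_trans by blast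
    qed
    thus ?thesis
      unfolding r_def S using le_closure_alg[OF D_mult_in_upsets[OF \<XX>] x] by blast
  qed
  ultimately show ?thesis unfolding alg is_alg_iff by blast
qed

lemma closure_alg_alg_closure:
  assumes "is_alg S"
  shows "closure_alg (alg_closure S) = S"
proof -
  obtain X r where S: "S = (X, r)" by fastforce
  interpret lax_algebra X r using assms by unfold_locales (simp add: S)
  have "(\<lambda>(\<xx>, x)\<in>upsets X \<times> X. INF A\<in>{A. A \<subseteq> X \<and> X - A \<notin> \<xx>}.
      (\<lambda>(A, x)\<in>Pow X \<times> X. r (grill X A, x)) (A, x)) = r"
  proof (rule extensionalityI[of _ "upsets X \<times> X"])
    show "r \<in> extensional (upsets X \<times> X)" using matrix by (auto simp: matrices_def PiE_def)
    fix p assume "p \<in> upsets X \<times> X"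
    thus "(\<lambda>(\<xx>, x)\<in>upsets X \<times> X. INF A\<in>{A. A \<subseteq> X \<and> X - A \<notin> \<xx>}.
      (\<lambda>(A, x)\<in>Pow X \<times> X. r (grill X A, x)) (A, x)) p = r p"
      by (auto simp: eq_INF_grill intro!: INF_cong)
  qed simp
  thus ?thesis by (simp add: S alg_closure_def closure_alg_def)
qed

lemma alg_closure_closure_alg:
  assumes "is_closure_space S"
  shows "alg_closure (closure_alg S) = S"
proof -
  obtain X c where S: "S = (X, c)" by fastforce
  interpret closure_space X c using assms by unfold_locales (simp add: S)
  have "(\<lambda>(A, x)\<in>Pow X \<times> X. snd (closure_alg (X, c)) (grill X A, x)) = c"
  proof (rule extensionalityI[of _ "Pow X \<times> X"])
    show "c \<in> extensional (Pow X \<times> X)" using matrix by (auto simp: matrices_def PiE_def)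
  qed (auto simp: closure_alg_grill)
  thus ?thesis by (simp add: S alg_closure_def closure_alg_def)
qed

section \<open>Morphisms\<close>

text \<open>Literal equality of hom-sets lets both functors act as the identity on morphisms. One
  inclusion evaluates at grills; the other bounds each term of the infimum formula for
  \<open>s\<close>.\<close>

lemma alg_hom_eq_closure_hom:
  assumes "is_alg S" "is_alg T"
  shows "alg_hom S T = closure_hom (alg_closure S) (alg_closure T)"
proof -
  obtain X r Y s where S: "S = (X, r)" and T: "T = (Y, s)" by fastforce
  interpret r: lax_algebra X r using assms by unfold_locales (simp add: S)
  interpret s: lax_algebra Y s using assms by unfold_locales (simp add: T)
  have alg: "(\<forall>\<xx>\<in>upsets X. \<forall>y\<in>X. r (\<xx>, y) \<le> s (D_map X Y f \<xx>, f y)) \<longleftrightarrow>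
      (\<forall>A x. A \<subseteq> X \<longrightarrow> x \<in> X \<longrightarrow> r (grill X A, x) \<le> s (grill Y (f ` A), f x))" (is "?L \<longleftrightarrow> ?R")
    if f: "f \<in> X \<rightarrow>\<^sub>E Y" for f
  proof
    have im: "f ` X \<subseteq> Y" using f by auto
    show ?R if ?L
      using that D_map_grill[OF im] grill_in_upsets[of X] by metis
    show ?L if R: ?R
    proof (intro ballI)
      fix \<xx> y assume \<xx>: "\<xx> \<in> upsets X" and y: "y \<in> X"
      hence fy: "f y \<in> Y" using im by blast
      have "r (\<xx>, y) \<le> s (grill Y B, f y)" if B: "B \<subseteq> Y" "Y - B \<notin> D_map X Y f \<xx>" for B
      proof -
        \<comment> \<open>Preimages commute with complements, so \<open>?A\<close> is admissible for
          \<xx> whenever \<open>B\<close> is admissible for its image, and \<open>f\<close> sends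
          \<open>?A\<close> into \<open>B\<close>.\<close>
        let ?A = "f -` B \<inter> X"
        have "f -` (Y - B) \<inter> X = X - ?A" using im by auto
        hence "X - ?A \<notin> \<xx>" using B by (auto simp: D_map_def)
        hence "r (\<xx>, y) \<le> r (grill X ?A, y)"
          by (intro r.mono \<xx> y) (auto simp: upset_subset_grill_iff[OF \<xx>])
        also have "\<dots> \<le> s (grill Y (f ` ?A), f y)" using R y by blast
        also have "\<dots> \<le> s (grill Y B, f y)"
          by (intro s.mono grill_mono fy) auto
        finally show ?thesis .
      qed
      thus "r (\<xx>, y) \<le> s (D_map X Y f \<xx>, f y)"
        unfolding s.eq_INF_grill[OF D_map_in_upsets[OF \<xx>] fy] by (intro INF_greatest) auto
    qed
  qed
  have closure: "f \<in> closure_hom (alg_closure S) (alg_closure T) \<longleftrightarrow>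
      (\<forall>A x. A \<subseteq> X \<longrightarrow> x \<in> X \<longrightarrow> r (grill X A, x) \<le> s (grill Y (f ` A), f x))"
    if f: "f \<in> X \<rightarrow>\<^sub>E Y" for f
  proof -
    have "f ` A \<subseteq> Y" if "A \<subseteq> X" for A using f that by auto
    moreover have "f x \<in> Y" if "x \<in> X" for x using f that by auto
    ultimately show ?thesis
      using f by (simp add: S T closure_hom_def alg_closure_def cong: imp_cong)
  qed
  have map: "f \<in> X \<rightarrow>\<^sub>E Y" if "f \<in> closure_hom (alg_closure S) (alg_closure T)" for f
    using that by (simp add: S T closure_hom_def alg_closure_def)
  have "f \<in> alg_hom S T \<longleftrightarrow> f \<in> closure_hom (alg_closure S) (alg_closure T)" for f
  proof (cases "f \<in> X \<rightarrow>\<^sub>E Y")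
    case True
    thus ?thesis unfolding closure[OF True] alg[OF True, symmetric] by (simp add: S T alg_hom_def)
  next
    case False
    moreover from this have "f \<notin> closure_hom (alg_closure S) (alg_closure T)" using map by metis
    ultimately show ?thesis by (simp add: S T alg_hom_def)
  qed
  thus ?thesis by (rule set_eqI)
qed

text \<open>The category laws are checked by hand only here; those of \<open>Alg\<close> are later
  pulled back along \<open>alg_closure\<close>.\<close>

lemma category_Cls: "category (Cls :: (('a, 'v::unital_quantale) closure_space, 'a \<Rightarrow> 'a) cat)"
proof
  fix S T U :: "('a, 'v) closure_space" and f g
  assume f: "f \<in> Hom Cls S T" and g: "g \<in> Hom Cls T U"
  obtain X c Y d Z e where S: "S = (X, c)" "T = (Y, d)" "U = (Z, e)" by (metis surj_pair)
  have "c (A, x) \<le> e (compose X g f ` A, compose X g f x)" if A: "A \<subseteq> X" and x: "x \<in> X" for A x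
  proof -
    have "f \<in> X \<rightarrow> Y" using f by (auto simp: S Cls_def closure_hom_def)
    hence "c (A, x) \<le> d (f ` A, f x)" "f ` A \<subseteq> Y" "f x \<in> Y"
      using f A x by (auto simp: S Cls_def closure_hom_def)
    moreover from this have "d (f ` A, f x) \<le> e (g ` f ` A, g (f x))"
      using g by (auto simp: S Cls_def closure_hom_def)
    moreover have "compose X g f ` A = g ` f ` A"
      using A by (auto simp: compose_def image_image intro!: image_cong)
    ultimately show ?thesis using x by (simp add: compose_eq)
  qed
  moreover have "compose X g f \<in> X \<rightarrow>\<^sub>E Z"
    using f g by (auto simp: S Cls_def closure_hom_def compose_def PiE_def)
  ultimately show "Comp Cls S T U g f \<in> Hom Cls S U"
    by (simp add: S Cls_def closure_hom_def)
next
  fix R S T U :: "('a, 'v) closure_space" and f g h :: "'a \<Rightarrow> 'a"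
  assume "f \<in> Hom Cls R S"
  hence "f \<in> fst R \<rightarrow> fst S" by (auto simp: Cls_def closure_hom_def split: prod.splits)
  thus "Comp Cls R S U (Comp Cls S T U h g) f = Comp Cls R T U h (Comp Cls R S T g f)"
    by (simp add: Cls_def compose_assoc)
next
  fix S :: "('a, 'v) closure_space"
  have "restrict (\<lambda>x. x) X ` A = A" if "A \<subseteq> X" for X A :: "'a set"
    using that by auto
  thus "Ident Cls S \<in> Hom Cls S S"
    by (auto simp: Cls_def closure_hom_def split: prod.split)
next
  fix S T :: "('a, 'v) closure_space" and f :: "'a \<Rightarrow> 'a"
  assume "f \<in> Hom Cls S T"
  hence f: "f \<in> fst S \<rightarrow>\<^sub>E fst T" by (auto simp: Cls_def closure_hom_def split: prod.splits)
  thus "Comp Cls S S T f (Ident Cls S) = f" "Comp Cls S T T (Ident Cls T) f = f"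
    by (auto simp: Cls_def compose_Id Id_compose PiE_def)
qed

theorem corollary5p8:
  assumes completely_distributive: "\<And>b::'v::unital_quantale. b = Sup {a. a \<prec> b}"
    and nontrivial: "(bot::'v) \<noteq> 1"
  shows "isomorphic_categories
    (Alg :: (('a, 'v) alg, 'a \<Rightarrow> 'a) cat) (Cls :: (('a, 'v) closure_space, 'a \<Rightarrow> 'a) cat)"
proof -
  let ?A = "Alg :: (('a, 'v) alg, 'a \<Rightarrow> 'a) cat"
  let ?C = "Cls :: (('a, 'v) closure_space, 'a \<Rightarrow> 'a) cat"
  interpret C: category ?C by (rule category_Cls)
  have Hom: "Hom ?A S T = Hom ?C (alg_closure S) (alg_closure T)"
    if "S \<in> Obj ?A" "T \<in> Obj ?A" for S T
    using that alg_hom_eq_closure_hom by (simp add: Alg_def Cls_def)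
  have Obj: "alg_closure S \<in> Obj ?C" if "S \<in> Obj ?A" for S
    using that is_closure_space_alg_closure by (simp add: Alg_def Cls_def)
  have Obj': "closure_alg S \<in> Obj ?A" "alg_closure (closure_alg S) = S" if "S \<in> Obj ?C" for S
    using that is_alg_closure_alg alg_closure_closure_alg by (simp_all add: Alg_def Cls_def)
  have Ident: "Ident ?A S = Ident ?C (alg_closure S)" for S
    by (simp add: Alg_def Cls_def)
  have Comp: "Comp ?A S T U = Comp ?C (alg_closure S) (alg_closure T) (alg_closure U)" for S T U
    by (simp add: Alg_def Cls_def)
  \<comment> \<open>Identities and composition depend only on carriers, which
    \<open>alg_closure\<close> preserves, so with \<open>Hom\<close> every law is an instance of the
    one in \<open>?C\<close>.\<close>
  interpret A: category ?A
  proof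
    fix S T U :: "('a, 'v) alg" and f g
    show "S \<in> Obj ?A \<Longrightarrow> Ident ?A S \<in> Hom ?A S S"
      by (simp add: Hom Ident Obj C.Ident_in)
    show "\<lbrakk>S \<in> Obj ?A; T \<in> Obj ?A; U \<in> Obj ?A; f \<in> Hom ?A S T; g \<in> Hom ?A T U\<rbrakk>
        \<Longrightarrow> Comp ?A S T U g f \<in> Hom ?A S U"
      unfolding Comp by (simp add: Hom) (rule C.Comp_in; simp add: Obj)
    show "\<lbrakk>S \<in> Obj ?A; T \<in> Obj ?A; f \<in> Hom ?A S T\<rbrakk> \<Longrightarrow> Comp ?A S S T f (Ident ?A S) = f"
      unfolding Comp Ident by (rule C.Comp_Ident_right) (simp_all add: Obj Hom)
    show "\<lbrakk>S \<in> Obj ?A; T \<in> Obj ?A; f \<in> Hom ?A S T\<rbrakk> \<Longrightarrow> Comp ?A S T T (Ident ?A T) f = f"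
      unfolding Comp Ident by (rule C.Comp_Ident_left) (simp_all add: Obj Hom)
  next
    fix R S T U :: "('a, 'v) alg" and f g h
    show "\<lbrakk>R \<in> Obj ?A; S \<in> Obj ?A; T \<in> Obj ?A; U \<in> Obj ?A;
        f \<in> Hom ?A R S; g \<in> Hom ?A S T; h \<in> Hom ?A T U\<rbrakk>
      \<Longrightarrow> Comp ?A R S U (Comp ?A S T U h g) f = Comp ?A R T U h (Comp ?A R S T g f)"
      unfolding Comp by (rule C.Comp_assoc) (simp_all add: Obj Hom)
  qed
  have "cat_functor ?A ?C alg_closure (\<lambda>_ _ f. f)"
    by unfold_locales (simp_all add: Obj Hom Ident Comp)
  moreover have "cat_functor ?C ?A closure_alg (\<lambda>_ _ f. f)"
    by unfold_locales (simp_all add: Obj' Hom Ident Comp)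
  moreover have "\<forall>S\<in>Obj ?A. closure_alg (alg_closure S) = S"
    by (simp add: Alg_def closure_alg_alg_closure)
  ultimately show ?thesis
    unfolding isomorphic_categories_def using Obj'(2) by blast
qed

end
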